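(* Let $n\ge 3$ and let $G$ be the 1-subdivision of the complete graph $K_n$, i.e. the graph obtained from $K_n$ by adding one new vertex in the middle of each edge. The ordinary cop number of $G$ (robber of speed $1$) is $2$, but if the robber can move at speed $2$, then the cop number of $G$ is $\lceil n/2\rceil=\Theta(\sqrt{v(G)})$, where $v(G)$ denotes the number of vertices of $G$.
   Context: Cops and Robbers with a robber of speed $R$ on a graph $G$: a perfect information game between a set of cops and one robber. First the cops are placed on vertices of their choice (several cops may share a vertex); then the robber, knowing the cops' placement, chooses a vertex. Then the cops and the robber move in alternate rounds, the cops moving first. In a cops' move each cop stays put or moves along one edge. In the robber's move he may traverse any walk of at most $R$ edges starting at his current position (possibly staying put), but he is not allowed to pass through (or end at) any vertex occupied by a cop. The cops win if eventually a cop steps onto the vertex currently occupied by the robber; the robber wins if he can elude the cops indefinitely. The cop number (against a robber of speed $R$) is the minimum number of cops that have a winning strategy on $G$; the ordinary cop number is the case $R=1$. *)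

theory Defs
  imports "Graph_Theory.Kuratowski" "Graph_Theory.Vertex_Walk" "HOL-Library.Landau_Symbols"
begin

section \<open>Complete graphs and 1-subdivisions\<close>

text \<open>An undirected simple graph is represented, as in the session Graph_Theory, by a finite
  loop-free digraph with a symmetric arc set (locale \<open>pair_graph\<close>).\<close>

definition complete_graph :: "nat \<Rightarrow> nat pair_pre_digraph" where
  "complete_graph n = \<lparr> pverts = {..<n}, parcs = {(u, v). u < n \<and> v < n \<and> u \<noteq> v} \<rparr>"

lemma pair_graph_complete_graph: "pair_graph (complete_graph n)"
proof -
  have "finite {(u, v). u < n \<and> v < n \<and> u \<noteq> v}"
    by (rule finite_subset[of _ "{..<n} \<times> {..<n}"]) auto
  then show ?thesis
    by unfold_locales (auto simp: complete_graph_def symmetric_def sym_def)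
qed

lemma complete_digraph_complete_graph: "K\<^bsub>n\<^esub> (with_proj (complete_graph n))"
proof -
  interpret pair_graph "complete_graph n" by (rule pair_graph_complete_graph)
  have "graph (with_proj (complete_graph n))" by unfold_locales
  then show ?thesis
    unfolding complete_digraph_def by (auto simp: complete_graph_def)
qed

definition undirected_edges :: "'a pair_pre_digraph \<Rightarrow> 'a set set" where
  "undirected_edges G = {{u, v} |u v. (u, v) \<in> parcs G}"

text \<open>\<open>Inl x\<close> is the original vertex \<open>x\<close>, and \<open>Inr e\<close> is the new vertex in the middle of the
  edge \<open>e\<close>, which is joined to the two ends of \<open>e\<close>.\<close>

definition one_subdivision :: "'a pair_pre_digraph \<Rightarrow> ('a + 'a set) pair_pre_digraph" where
  "one_subdivision G =
    \<lparr> pverts = Inl ` pverts G \<union> Inr ` undirected_edges G,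
      parcs = {(Inl x, Inr e) |x e. e \<in> undirected_edges G \<and> x \<in> e}
            \<union> {(Inr e, Inl x) |x e. e \<in> undirected_edges G \<and> x \<in> e} \<rparr>"

lemma pair_graph_one_subdivision:
  assumes "pair_graph G"
  shows "pair_graph (one_subdivision G)"
proof -
  interpret pair_graph G by fact
  have E: "undirected_edges G = (\<lambda>(u, v). {u, v}) ` parcs G"
    unfolding undirected_edges_def by auto
  have EV: "x \<in> pverts G" if "e \<in> undirected_edges G" "x \<in> e" for x e
    using that in_arcsD1 in_arcsD2 unfolding undirected_edges_def by auto
  have fin: "finite (pverts (one_subdivision G))"
    by (simp add: one_subdivision_def E pair_finite_verts pair_finite_arcs)
  have sub: "parcs (one_subdivision G) \<subseteq> pverts (one_subdivision G) \<times> pverts (one_subdivision G)"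
    using EV by (auto simp: one_subdivision_def)
  have "finite (parcs (one_subdivision G))"
    using finite_subset[OF sub] fin by blast
  with fin show ?thesis
    by unfold_locales (auto simp: symmetric_def sym_def one_subdivision_def EV)
qed


section \<open>Cops and Robbers with a robber of speed \<open>R\<close>\<close>

text \<open>A position of \<open>k\<close> cops is a list of \<open>k\<close> vertices, possibly with repetitions; its
  \<open>i\<close>-th entry is the vertex of the \<open>i\<close>-th cop.\<close>

definition cops_move :: "'v pair_pre_digraph \<Rightarrow> 'v list \<Rightarrow> 'v list \<Rightarrow> bool" where
  "cops_move G = list_all2 (\<lambda>u v. u = v \<or> (u, v) \<in> parcs G)"

definition robber_move ::
    "'v pair_pre_digraph \<Rightarrow> nat \<Rightarrow> 'v list \<Rightarrow> 'v \<Rightarrow> 'v \<Rightarrow> bool" where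
  "robber_move G R cs u v \<longleftrightarrow>
    (\<exists>p. vwalk p (with_proj G) \<and> hd p = u \<and> last p = v \<and> vwalk_length p \<le> R \<and>
         set p \<inter> set cs = {})"

text \<open>A strategy of the cops maps the list of all positions that the robber has occupied so far
  (oldest first) to the position that the cops take next. Their earlier positions need not be
  arguments, as the strategy itself determines them: \<open>\<sigma> []\<close> is the initial placement, and
  \<open>\<sigma> [r\<^sub>0, \<dots>, r\<^sub>t]\<close> is the position after the \<open>(t+1)\<close>-st cops' move. Requiring legal moves also
  for lists that arise in no play is harmless, because the cops can always stay put.\<close>

definition cop_strategy :: "'v pair_pre_digraph \<Rightarrow> nat \<Rightarrow> ('v list \<Rightarrow> 'v list) \<Rightarrow> bool" where
  "cop_strategy G k \<sigma> \<longleftrightarrow>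
    length (\<sigma> []) = k \<and> set (\<sigma> []) \<subseteq> pverts G \<and>
    (\<forall>h r. set (h @ [r]) \<subseteq> pverts G \<longrightarrow> cops_move G (\<sigma> h) (\<sigma> (h @ [r])))"

text \<open>If the robber is at \<open>r 0\<close> after the placement and at \<open>r t\<close> after his \<open>t\<close>-th move, then
  \<open>cops_at \<sigma> r t\<close> is the position of the cops after their \<open>t\<close>-th move.\<close>

definition cops_at :: "('v list \<Rightarrow> 'v list) \<Rightarrow> (nat \<Rightarrow> 'v) \<Rightarrow> nat \<Rightarrow> 'v list" where
  "cops_at \<sigma> r t = \<sigma> (map r [0..<t])"

text \<open>The robber at \<open>r t\<close> is caught when the cops, in their next move, step onto \<open>r t\<close>. The set
  \<open>cops_at \<sigma> r t\<close> matters only for \<open>t = 0\<close>: a robber who starts on a vertex occupied by a cop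
  is caught at once, whereas his later moves always avoid the cops.\<close>

definition caught :: "('v list \<Rightarrow> 'v list) \<Rightarrow> (nat \<Rightarrow> 'v) \<Rightarrow> nat \<Rightarrow> bool" where
  "caught \<sigma> r t \<longleftrightarrow> r t \<in> set (cops_at \<sigma> r t) \<union> set (cops_at \<sigma> r (Suc t))"

text \<open>The play is over once the robber is caught; the values of \<open>r\<close> after that time are
  unconstrained and have no meaning.\<close>

definition robber_play ::
    "'v pair_pre_digraph \<Rightarrow> nat \<Rightarrow> ('v list \<Rightarrow> 'v list) \<Rightarrow> (nat \<Rightarrow> 'v) \<Rightarrow> bool" where
  "robber_play G R \<sigma> r \<longleftrightarrow>
    r 0 \<in> pverts G \<and>
    (\<forall>t. (\<forall>s\<le>t. \<not> caught \<sigma> r s) \<longrightarrow>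
         robber_move G R (cops_at \<sigma> r (Suc t)) (r t) (r (Suc t)))"

definition winning_cop_strategy ::
    "'v pair_pre_digraph \<Rightarrow> nat \<Rightarrow> nat \<Rightarrow> ('v list \<Rightarrow> 'v list) \<Rightarrow> bool" where
  "winning_cop_strategy G R k \<sigma> \<longleftrightarrow>
    cop_strategy G k \<sigma> \<and> (\<forall>r. robber_play G R \<sigma> r \<longrightarrow> (\<exists>t. caught \<sigma> r t))"

text \<open>On a finite graph the minimum exists, since a cop on every vertex wins.\<close>

definition cop_number :: "nat \<Rightarrow> 'v pair_pre_digraph \<Rightarrow> nat" where
  "cop_number R G = (LEAST k. \<exists>\<sigma>. winning_cop_strategy G R k \<sigma>)"

end

theory Submission
  imports Defs
begin

text \<open>A cop on a vertex of the subdivided complete graph dominates at most two original vertices.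
  Hence, if \<open>2k < n\<close>, some original vertex is dominated by none of \<open>k\<close> cops, and a robber of
  speed \<open>2\<close> who sits on an original vertex can reach it: its middle vertex towards any other
  vertex carries no cop. Conversely \<open>\<lceil>n/2\<rceil>\<close> cops placed on an edge cover dominate all original
  vertices, so the robber has to start on a middle vertex, whose two ends are then occupied by two
  different cops; he is stuck whatever his speed. Against a robber of speed \<open>1\<close> one cop
  chases him and the other one guards the end towards which he is driven; one cop alone fails
  because the graph has no triangle and minimum degree at least \<open>2\<close>.\<close>

section \<open>Winning positions and evasion\<close>

definition dominated :: "'v pair_pre_digraph \<Rightarrow> 'v list \<Rightarrow> 'v \<Rightarrow> bool" where
  "dominated G cs r \<longleftrightarrow> (\<exists>c\<in>set cs. c = r \<or> (c, r) \<in> parcs G)"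

text \<open>The game seen positionally, with the cops to move: the number bounds the cops' moves
  that remain. This replaces reasoning about histories by backward induction.\<close>

fun cops_win_in :: "'v pair_pre_digraph \<Rightarrow> nat \<Rightarrow> nat \<Rightarrow> 'v list \<Rightarrow> 'v \<Rightarrow> bool" where
  "cops_win_in G R 0 cs r \<longleftrightarrow> False"
| "cops_win_in G R (Suc m) cs r \<longleftrightarrow>
    (\<exists>cs'. cops_move G cs cs' \<and>
      (r \<in> set cs' \<or> (\<forall>r'. robber_move G R cs' r r' \<longrightarrow> cops_win_in G R m cs' r')))"

lemma cops_move_refl: "cops_move G cs cs"
  by (simp add: cops_move_def list_all2_refl)

lemma dominated_cops_move:
  assumes "cops_move G cs cs'" "r \<in> set cs'"
  shows "dominated G cs r"
  using assms unfolding cops_move_def dominated_def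
  by (fastforce simp: list_all2_conv_all_nth in_set_conv_nth)

text \<open>Only the dominating cop has to move. A capture ends the game, so any positive bound on
  the moves will do; the winning lines below all end with this lemma.\<close>

lemma cops_win_in_dominated:
  assumes "dominated G cs r"
  shows "cops_win_in G R (Suc m) cs r"
proof -
  obtain i where "i < length cs" "cs ! i = r \<or> (cs ! i, r) \<in> parcs G"
    using assms by (auto simp: dominated_def in_set_conv_nth)
  then have "cops_move G cs (cs[i := r])" "r \<in> set (cs[i := r])"
    by (auto simp: cops_move_def list_all2_conv_all_nth nth_list_update set_update_memI)
  then show ?thesis
    by auto
qed

text \<open>Bridge from positions to strategies: a cop move that shortens the win is chosen for each
  position, and the bound cannot decrease forever.\<close>

lemma winning_cop_strategy_if_cops_win_in:
  assumes len: "length cs\<^sub>0 = k" and sub: "set cs\<^sub>0 \<subseteq> pverts G"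
    and win: "\<And>r. r \<in> pverts G \<Longrightarrow> \<exists>m. cops_win_in G R m cs\<^sub>0 r"
  shows "\<exists>\<sigma>. winning_cop_strategy G R k \<sigma>"
proof -
  \<comment> \<open>The move is fixed before \<open>m\<close> is quantified: the one belonging to
    the least bound \<open>l\<close> serves every \<open>m\<close>. In positions that are never won
    the cops stay put, which makes the choice total.\<close>
  have "\<exists>cs'. cops_move G cs cs' \<and> (\<forall>m. cops_win_in G R m cs r \<longrightarrow>
      r \<in> set cs' \<or> (\<exists>m'<m. \<forall>r'. robber_move G R cs' r r' \<longrightarrow> cops_win_in G R m' cs' r'))" for cs r
  proof (cases "\<exists>m. cops_win_in G R m cs r")
    case True
    define l where "l = (LEAST m. cops_win_in G R m cs r)"
    have l: "cops_win_in G R l cs r"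
      using True LeastI_ex unfolding l_def by metis
    have least: "l \<le> m" if "cops_win_in G R m cs r" for m
      using that unfolding l_def by (rule Least_le)
    from l obtain m' where "l = Suc m'"
      by (cases l) auto
    with l least show ?thesis
      by (metis Suc_le_lessD cops_win_in.simps(2))
  next
    case False
    then show ?thesis
      using cops_move_refl by blast
  qed
  then obtain next_cops where move: "cops_move G cs (next_cops cs r)"
    and progress: "cops_win_in G R m cs r \<Longrightarrow> r \<in> set (next_cops cs r) \<or>
      (\<exists>m'<m. \<forall>r'. robber_move G R (next_cops cs r) r r' \<longrightarrow> cops_win_in G R m' (next_cops cs r) r')"
    for cs r m
    by metis
  \<comment> \<open>Folding recovers the cops' current position from the robber's history, so a
    positional rule becomes a strategy on histories.\<close>
  define \<sigma> where "\<sigma> = foldl next_cops cs\<^sub>0"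
  have \<sigma>_snoc: "\<sigma> (h @ [r]) = next_cops (\<sigma> h) r" for h r
    by (simp add: \<sigma>_def)
  have \<sigma>_Nil: "\<sigma> [] = cs\<^sub>0"
    by (simp add: \<sigma>_def)
  have cops_at_Suc: "cops_at \<sigma> r (Suc t) = next_cops (cops_at \<sigma> r t) (r t)" for r t
    by (simp add: cops_at_def \<sigma>_snoc)
  have "\<exists>t. caught \<sigma> r t" if play: "robber_play G R \<sigma> r" for r
  proof (rule ccontr)
    assume free: "\<nexists>t. caught \<sigma> r t"
    \<comment> \<open>Infinite descent: while the robber is free, a win within \<open>m\<close>
      moves at time \<open>t\<close> gives a win within fewer moves at the next time.\<close>
    have "\<not> cops_win_in G R m (cops_at \<sigma> r t) (r t)" for m t
    proof (induction m arbitrary: t rule: less_induct)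
      case (less m)
      have "r t \<notin> set (cops_at \<sigma> r (Suc t))"
        using free by (auto simp: caught_def)
      moreover have "robber_move G R (cops_at \<sigma> r (Suc t)) (r t) (r (Suc t))"
        using play free by (auto simp: robber_play_def)
      ultimately show ?case
        using progress less.IH by (metis cops_at_Suc)
    qed
    moreover have "\<exists>m. cops_win_in G R m (cops_at \<sigma> r 0) (r 0)"
      using win play by (simp add: cops_at_def \<sigma>_Nil robber_play_def)
    ultimately show False
      by blast
  qed
  moreover have "cop_strategy G k \<sigma>"
    using len sub move by (simp add: cop_strategy_def \<sigma>_Nil \<sigma>_snoc)
  ultimately show ?thesis
    unfolding winning_cop_strategy_def by blast
qed

text \<open>The robber keeps an invariant: after each of his moves he is in \<open>S\<close> and no
  cop can reach him in one move. The next cops' move then cannot catch him, and \<open>step\<close>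
  restores the invariant.\<close>

lemma not_winning_if_evasion:
  assumes S: "S \<subseteq> pverts G"
    and init: "\<And>cs. length cs = k \<Longrightarrow> \<exists>r\<in>S. \<not> dominated G cs r"
    and step: "\<And>cs r. length cs = k \<Longrightarrow> r \<in> S \<Longrightarrow> r \<notin> set cs \<Longrightarrow>
      \<exists>r'\<in>S. robber_move G R cs r r' \<and> \<not> dominated G cs r'"
  shows "\<not> winning_cop_strategy G R k \<sigma>"
proof
  assume "winning_cop_strategy G R k \<sigma>"
  then have strat: "cop_strategy G k \<sigma>"
    and win: "robber_play G R \<sigma> r \<Longrightarrow> \<exists>t. caught \<sigma> r t" for r
    by (auto simp: winning_cop_strategy_def)
  have move: "cops_move G (\<sigma> h) (\<sigma> (h @ [r]))" if "set (h @ [r]) \<subseteq> pverts G" for h r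
    using strat that unfolding cop_strategy_def by blast
  have len: "length (\<sigma> h) = k" if "set h \<subseteq> pverts G" for h
    using that
  proof (induction h rule: rev_induct)
    case Nil
    then show ?case
      using strat by (simp add: cop_strategy_def)
  next
    case (snoc r h)
    then show ?case
      using move[of h r] by (auto simp: cops_move_def dest: list_all2_lengthD)
  qed
  \<comment> \<open>\<open>butlast\<close> because the cops in place when the robber chooses
    \<open>last h\<close> have seen only the earlier entries. Dependent choice runs over whole
    histories since the strategy reads them.\<close>
  define P where "P t h \<longleftrightarrow> length h = Suc t \<and> set h \<subseteq> S \<and> \<not> dominated G (\<sigma> (butlast h)) (last h)"
    for t :: nat and h
  define Q where "Q t h h' \<longleftrightarrow> (\<exists>r. h' = h @ [r] \<and> robber_move G R (\<sigma> h) (last h) r)"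
    for t :: nat and h h'
  have "\<exists>f. \<forall>t. P t (f t) \<and> Q t (f t) (f (Suc t))"
  proof (rule dependent_nat_choice)
    obtain r where "r \<in> S" "\<not> dominated G (\<sigma> []) r"
      using init len[of "[]"] by auto
    then show "\<exists>h. P 0 h"
      by (intro exI[of _ "[r]"]) (simp add: P_def)
  next
    fix h t
    assume P: "P t h"
    then obtain g r where h: "h = g @ [r]"
      by (cases h rule: rev_cases) (auto simp: P_def)
    have V: "set h \<subseteq> pverts G"
      using P S by (auto simp: P_def)
    have "r \<notin> set (\<sigma> h)"
      using P V h move[of g r] dominated_cops_move by (fastforce simp: P_def)
    then obtain r' where "r' \<in> S" "robber_move G R (\<sigma> h) r r'" "\<not> dominated G (\<sigma> h) r'"
      using step[of "\<sigma> h" r] len[OF V] P h by (auto simp: P_def)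
    then show "\<exists>h'. P (Suc t) h' \<and> Q t h h'"
      using P h by (intro exI[of _ "h @ [r']"]) (simp add: P_def Q_def butlast_append)
  qed
  then obtain f where P: "P t (f t)" and Q: "Q t (f t) (f (Suc t))" for t
    by blast
  define r where "r t = last (f t)" for t
  have f: "f t = map r [0..<Suc t]" for t
  proof (induction t)
    case 0
    show ?case
      using P[of 0] by (auto simp: P_def r_def length_Suc_conv)
  next
    case (Suc t)
    then show ?case
      using Q[of t] by (auto simp: Q_def r_def)
  qed
  have rS: "r t \<in> S" for t
    using P[of t] by (auto simp: P_def f)
  have free: "\<not> dominated G (cops_at \<sigma> r t) (r t)" for t
    using P[of t] by (simp add: P_def f cops_at_def)
  have "robber_move G R (cops_at \<sigma> r (Suc t)) (r t) (r (Suc t))" for t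
    using Q[of t] by (auto simp: Q_def f cops_at_def)
  then have "robber_play G R \<sigma> r"
    using rS S by (auto simp: robber_play_def)
  then obtain t where "caught \<sigma> r t"
    using win by blast
  \<comment> \<open>Being caught means that a cop is on \<open>r t\<close> already or reaches it by
    one legal move; both contradict \<open>free\<close>.\<close>
  moreover have "set (map r [0..<t] @ [r t]) \<subseteq> pverts G"
    using rS S by auto
  then have "cops_move G (cops_at \<sigma> r t) (cops_at \<sigma> r (Suc t))"
    using move[of "map r [0..<t]" "r t"] by (simp add: cops_at_def)
  ultimately show False
    using free[of t] dominated_cops_move by (fastforce simp: caught_def dominated_def)
qed

section \<open>Single moves of the robber\<close>

text \<open>A walk of any length needs a first step, and every first step is blocked; hence speed is
  of no help.\<close>

lemma robber_move_stuck:
  assumes "robber_move G R cs u v" "\<And>w. (u, w) \<in> parcs G \<Longrightarrow> w \<in> set cs"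
  shows "v = u"
proof -
  obtain p where p: "vwalk p (with_proj G)" "hd p = u" "last p = v" "set p \<inter> set cs = {}"
    using assms(1) by (auto simp: robber_move_def)
  obtain q where q: "p = u # q"
    using p(1,2) by (cases p) auto
  have "q = []"
  proof (cases q)
    case (Cons w q')
    then have "(u, w) \<in> parcs G" "w \<in> set p"
      using p(1) q by (auto simp: vwalk_def arcs_ends_def arc_to_ends_def)
    then show ?thesis
      using assms(2) p(4) by auto
  qed
  then show ?thesis
    using p(3) q by simp
qed

lemma robber_move_speed_1:
  assumes "robber_move G 1 cs u v"
  shows "v \<notin> set cs" "v = u \<or> (u, v) \<in> parcs G"
proof -
  obtain p where p: "vwalk p (with_proj G)" "hd p = u" "last p = v" "length p - 1 \<le> 1"
    "set p \<inter> set cs = {}"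
    using assms by (auto simp: robber_move_def)
  have "p = [u] \<or> (\<exists>w. p = [u, w])"
    using p(1,2,4) by (cases p; cases "tl p") auto
  then show "v \<notin> set cs" "v = u \<or> (u, v) \<in> parcs G"
    using p(1,3,5) by (auto simp: vwalk_def arcs_ends_def arc_to_ends_def)
qed

lemma robber_move_stay:
  assumes "u \<in> pverts G" "u \<notin> set cs"
  shows "robber_move G R cs u u"
  unfolding robber_move_def using assms
  by (intro exI[of _ "[u]"]) (auto simp: vwalk_def)

section \<open>The subdivided complete graph\<close>

abbreviation subdivided_complete :: "nat \<Rightarrow> (nat + nat set) pair_pre_digraph" where
  "subdivided_complete n \<equiv> one_subdivision (complete_graph n)"

lemma undirected_edges_complete:
  "e \<in> undirected_edges (complete_graph n) \<longleftrightarrow> (\<exists>x y. x < n \<and> y < n \<and> x \<noteq> y \<and> e = {x, y})"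
  by (auto simp: undirected_edges_def complete_graph_def)

lemma pverts_subdivided_complete:
  "u \<in> pverts (subdivided_complete n) \<longleftrightarrow>
    (\<exists>x<n. u = Inl x) \<or> (\<exists>x y. x < n \<and> y < n \<and> x \<noteq> y \<and> u = Inr {x, y})"
proof -
  have "u \<in> pverts (subdivided_complete n) \<longleftrightarrow>
      (\<exists>x<n. u = Inl x) \<or> (\<exists>e\<in>undirected_edges (complete_graph n). u = Inr e)"
    by (simp add: one_subdivision_def complete_graph_def image_iff Bex_def)
  then show ?thesis
    unfolding Bex_def undirected_edges_complete by blast
qed

lemma doubleton_in_undirected_edges_complete:
  "{x, y} \<in> undirected_edges (complete_graph n) \<longleftrightarrow> x < n \<and> y < n \<and> x \<noteq> y"
  by (auto simp: undirected_edges_complete doubleton_eq_iff)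

lemma parcs_one_subdivision:
  "(Inl x, v) \<in> parcs (one_subdivision G) \<longleftrightarrow> (\<exists>e. v = Inr e \<and> e \<in> undirected_edges G \<and> x \<in> e)"
  "(Inr e, v) \<in> parcs (one_subdivision G) \<longleftrightarrow> (\<exists>x. v = Inl x \<and> e \<in> undirected_edges G \<and> x \<in> e)"
  by (auto simp: one_subdivision_def)

lemmas subdivided_complete_arcs = parcs_one_subdivision doubleton_in_undirected_edges_complete

lemma parcs_subdivided_complete:
  "(u, v) \<in> parcs (subdivided_complete n) \<longleftrightarrow>
    (\<exists>x y. x < n \<and> y < n \<and> x \<noteq> y \<and>
      (u = Inl x \<and> v = Inr {x, y} \<or> u = Inr {x, y} \<and> v = Inl x))"
proof -
  have "e \<in> undirected_edges (complete_graph n) \<and> x \<in> e \<longleftrightarrow>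
      (\<exists>y. x < n \<and> y < n \<and> x \<noteq> y \<and> e = {x, y})" for x e
    unfolding undirected_edges_complete by (auto; metis insert_commute)
  then show ?thesis
    by (cases u; cases v) (auto simp: parcs_one_subdivision)
qed

text \<open>There are \<open>n\<close> original and \<open>n choose 2\<close> middle vertices;
  doubling avoids the division.\<close>

lemma card_pverts_subdivided_complete:
  "2 * card (pverts (subdivided_complete n)) = n * (n + 1)"
proof -
  have "undirected_edges (complete_graph n) = {e. e \<subseteq> {..<n} \<and> card e = 2}"
    by (fastforce simp: undirected_edges_complete card_2_iff)
  then have "card (undirected_edges (complete_graph n)) = n choose 2"
    using n_subsets[of "{..<n}" 2] by simp
  moreover have "finite (undirected_edges (complete_graph n))"
    by (rule finite_subset[of _ "Pow {..<n}"]) (auto simp: undirected_edges_complete)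
  ultimately have "card (pverts (subdivided_complete n)) = n + (n choose 2)"
    unfolding one_subdivision_def
    by (subst pair_pre_digraph.simps, subst card_Un_disjoint)
      (auto simp: complete_graph_def card_image)
  moreover have "even (n * (n - 1))"
    by (cases n) auto
  ultimately show ?thesis
    by (cases n) (auto simp: choose_two algebra_simps)
qed

section \<open>Evading few cops\<close>

text \<open>A union bound over the cops, counting original vertices only.\<close>

lemma exists_undominated_vertex:
  assumes "2 * length cs < n"
  shows "\<exists>x<n. \<not> dominated (subdivided_complete n) cs (Inl x)"
proof -
  define D where "D c = {x. c = Inl x \<or> (c, Inl x) \<in> parcs (subdivided_complete n)}" for c
  have card_D: "finite (D c) \<and> card (D c) \<le> 2" for c
  proof -
    \<comment> \<open>A cop on a middle vertex reaches its two ends, one on an original vertex only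
      that vertex. Entries of \<open>cs\<close> that are no vertices are allowed as well: a
      non-doubleton \<open>Inr\<close> entry reaches nothing.\<close>
    have "\<exists>a b. D c \<subseteq> {a, b}"
    proof (cases "\<exists>a b. c = Inr {a, b}")
      case True
      then show ?thesis
        by (auto simp: D_def parcs_subdivided_complete doubleton_eq_iff)
    next
      case False
      then show ?thesis
        by (cases c) (auto simp: D_def parcs_subdivided_complete)
    qed
    then obtain a b where "D c \<subseteq> {a, b}"
      by blast
    moreover have "card {a, b} \<le> 2"
      by (simp add: card_insert_if)
    ultimately show ?thesis
      by (meson card_mono finite.intros finite_subset le_trans)
  qed
  have "card (\<Union>c\<in>set cs. D c) \<le> (\<Sum>c\<in>set cs. card (D c))"
    by (rule card_UN_le) simp
  also have "\<dots> \<le> (\<Sum>c\<in>set cs. 2)"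
    by (rule sum_mono) (simp add: card_D)
  also have "\<dots> \<le> 2 * length cs"
    using card_length[of cs] by simp
  finally have "card (\<Union>c\<in>set cs. D c) < card {..<n}"
    using assms by simp
  moreover have "finite (\<Union>c\<in>set cs. D c)"
    using card_D by simp
  ultimately have "\<not> {..<n} \<subseteq> (\<Union>c\<in>set cs. D c)"
    using card_mono leD by blast
  then show ?thesis
    by (auto simp: D_def dominated_def)
qed

text \<open>A cop on the middle vertex or on the target would dominate the target, so the path of
  two edges is free.\<close>

lemma robber_move_through_middle:
  assumes "x < n" "y < n" "Inl x \<notin> set cs" "\<not> dominated (subdivided_complete n) cs (Inl y)"
  shows "robber_move (subdivided_complete n) 2 cs (Inl x) (Inl y)"
proof (cases "x = y")
  case True
  then show ?thesis
    using assms by (auto intro: robber_move_stay simp: pverts_subdivided_complete)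
next
  case False
  have arcs: "(Inl x, Inr {x, y}) \<in> parcs (subdivided_complete n)"
    "(Inr {x, y}, Inl y) \<in> parcs (subdivided_complete n)"
    using assms(1,2) False by (auto simp: parcs_subdivided_complete)
  have "set [Inl x, Inr {x, y}, Inl y] \<inter> set cs = {}"
    using assms(3,4) arcs by (auto simp: dominated_def)
  moreover have "vwalk [Inl x, Inr {x, y}, Inl y] (with_proj (subdivided_complete n))"
    using arcs assms(1,2) False
    by (auto simp: vwalk_def arcs_ends_def arc_to_ends_def pverts_subdivided_complete)
  ultimately show ?thesis
    unfolding robber_move_def by (intro exI[of _ "[Inl x, Inr {x, y}, Inl y]"]) simp
qed

lemma not_winning_speed_2:
  assumes "2 * k < n"
  shows "\<not> winning_cop_strategy (subdivided_complete n) 2 k \<sigma>"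
proof (rule not_winning_if_evasion[where S = "Inl ` {..<n}"])
  show "Inl ` {..<n} \<subseteq> pverts (subdivided_complete n)"
    by (auto simp: pverts_subdivided_complete)
next
  fix cs :: "(nat + nat set) list"
  assume "length cs = k"
  then have ex: "\<exists>x<n. \<not> dominated (subdivided_complete n) cs (Inl x)"
    using exists_undominated_vertex assms by blast
  then show "\<exists>r\<in>Inl ` {..<n}. \<not> dominated (subdivided_complete n) cs r"
    by auto
  fix r :: "nat + nat set"
  assume "r \<in> Inl ` {..<n}" "r \<notin> set cs"
  with ex show "\<exists>r'\<in>Inl ` {..<n}. robber_move (subdivided_complete n) 2 cs r r' \<and>
      \<not> dominated (subdivided_complete n) cs r'"
    using robber_move_through_middle by blast
qed

text \<open>The graph is bipartite, so a second neighbour of \<open>r\<close> is on the side of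
  \<open>c\<close> and not adjacent to it. A second neighbour exists since all degrees are at least
  2.\<close>

lemma exists_other_neighbour:
  assumes "n \<ge> 3" "(c, r) \<in> parcs (subdivided_complete n)"
  shows "\<exists>r'. (r, r') \<in> parcs (subdivided_complete n) \<and> r' \<noteq> c \<and>
    (c, r') \<notin> parcs (subdivided_complete n)"
proof -
  obtain x y where xy: "x < n" "y < n" "x \<noteq> y"
    "c = Inl x \<and> r = Inr {x, y} \<or> c = Inr {x, y} \<and> r = Inl x"
    using assms(2) by (auto simp: parcs_subdivided_complete)
  \<comment> \<open>A third original vertex gives \<open>Inl x\<close> a neighbour besides
    \<open>Inr {x, y}\<close>; this is where \<open>n\<close> being at least 3 enters.\<close>
  have "\<not> {..<n} \<subseteq> {x, y}"
    using card_mono[of "{x, y}" "{..<n}"] assms(1) by (auto simp: card_insert_if split: if_splits)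
  then obtain z where "z < n" "z \<noteq> x" "z \<noteq> y"
    by auto
  from xy(4) show ?thesis
  proof
    assume "c = Inl x \<and> r = Inr {x, y}"
    then show ?thesis
      using xy(1-3) by (intro exI[of _ "Inl y"]) (auto simp: parcs_subdivided_complete)
  next
    assume "c = Inr {x, y} \<and> r = Inl x"
    then show ?thesis
      using xy(1-3) \<open>z < n\<close> \<open>z \<noteq> x\<close> \<open>z \<noteq> y\<close>
      by (intro exI[of _ "Inr {x, z}"]) (auto simp: parcs_subdivided_complete doubleton_eq_iff)
  qed
qed

lemma not_winning_speed_1:
  assumes "n \<ge> 3" "k \<le> 1"
  shows "\<not> winning_cop_strategy (subdivided_complete n) 1 k \<sigma>"
proof (rule not_winning_if_evasion[where S = "pverts (subdivided_complete n)"])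
  let ?G = "subdivided_complete n"
  fix cs :: "(nat + nat set) list"
  assume len: "length cs = k"
  show "\<exists>r\<in>pverts ?G. \<not> dominated ?G cs r"
    using exists_undominated_vertex[of cs n] assms len by (auto simp: pverts_subdivided_complete)
  fix r
  assume r: "r \<in> pverts ?G" "r \<notin> set cs"
  show "\<exists>r'\<in>pverts ?G. robber_move ?G 1 cs r r' \<and> \<not> dominated ?G cs r'"
  proof (cases "dominated ?G cs r")
    case False
    then show ?thesis
      using r robber_move_stay[OF r] by blast
  next
    case True
    \<comment> \<open>The robber stands on no cop, so domination means that the lone cop is adjacent
      to him, and he flees away from it.\<close>
    then obtain c where c: "cs = [c]" "(c, r) \<in> parcs ?G"
      using r(2) len assms(2) by (cases cs) (auto simp: dominated_def)
    obtain r' where r': "(r, r') \<in> parcs ?G" "r' \<noteq> c" "(c, r') \<notin> parcs ?G"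
      using exists_other_neighbour[OF assms(1) c(2)] by blast
    have V: "r' \<in> pverts ?G"
      using r'(1) by (auto simp: parcs_subdivided_complete pverts_subdivided_complete)
    have "vwalk [r, r'] (with_proj ?G)"
      using r(1) r'(1) V by (auto simp: vwalk_def arcs_ends_def arc_to_ends_def)
    then have "robber_move ?G 1 cs r r'"
      unfolding robber_move_def using r(2) r'(2) c(1) by (intro exI[of _ "[r, r']"]) auto
    then show ?thesis
      using V r' c(1) by (auto simp: dominated_def)
  qed
qed simp

section \<open>Catching the robber\<close>

lemma winning_speed_1:
  assumes "n \<ge> 3"
  shows "\<exists>\<sigma>. winning_cop_strategy (subdivided_complete n) 1 2 \<sigma>"
proof (rule winning_cop_strategy_if_cops_win_in)
  let ?G = "subdivided_complete n"
  show "length [Inl 0, Inl 1 :: nat + nat set] = 2"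
    by simp
  show "set [Inl 0, Inl 1] \<subseteq> pverts ?G"
    using assms by (auto simp: pverts_subdivided_complete)
  fix r
  assume r: "r \<in> pverts ?G"
  show "\<exists>m. cops_win_in ?G 1 m [Inl 0, Inl 1] r"
  proof (cases "dominated ?G [Inl 0, Inl 1] r")
    case True
    then show ?thesis
      by (blast intro: cops_win_in_dominated)
  next
    case undom: False
    \<comment> \<open>The cops start on \<open>Inl 0\<close> and \<open>Inl 1\<close>, so a middle
      vertex with end 0 or 1 would be dominated.\<close>
    have end_dom: "r = Inr {x, y} \<Longrightarrow> x < n \<Longrightarrow> y < n \<Longrightarrow> x \<noteq> y \<Longrightarrow> x \<notin> {0, 1}" for x y
      using undom by (auto simp: dominated_def subdivided_complete_arcs)
    from r consider (orig) v where "r = Inl v" "v < n"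
      | (middle) x y where "r = Inr {x, y}" "x < n" "y < n" "x \<noteq> y"
      by (auto simp: pverts_subdivided_complete)
    then show ?thesis
    proof cases
      case orig
      have v: "v \<noteq> 0" "v \<noteq> 1"
        using undom orig by (auto simp: dominated_def)
      \<comment> \<open>The cop on \<open>Inr {0, v}\<close> threatens \<open>Inl v\<close> and
        drives the robber out, while the one waiting on \<open>Inl 1\<close> makes the exit
        \<open>Inr {v, 1}\<close> a loss.\<close>
      have win: "cops_win_in ?G 1 (Suc (Suc 0)) [Inr {0, v}, Inl 1] r'"
        if move: "robber_move ?G 1 [Inr {0, v}, Inl 1] (Inl v) r'" for r'
      proof (cases "dominated ?G [Inr {0, v}, Inl 1] r'")
        case True
        then show ?thesis
          by (rule cops_win_in_dominated)
      next
        case False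
        have "r' \<noteq> Inl v"
          using False v orig(2) by (auto simp: dominated_def subdivided_complete_arcs)
        then obtain w where w: "w < n" "w \<noteq> v" "r' = Inr {v, w}"
          using robber_move_speed_1(2)[OF move] by (auto simp: parcs_subdivided_complete)
        have w1: "w \<noteq> 1"
          using False w orig(2) by (auto simp: dominated_def subdivided_complete_arcs)
        \<comment> \<open>The first cop follows to \<open>Inl v\<close>; the second guards the only
          other exit \<open>Inl w\<close>. Staying and leaving both lose.\<close>
        let ?cs = "[Inl v, Inr {1, w}]"
        have "cops_move ?G [Inr {0, v}, Inl 1] ?cs"
          using assms v w w1 orig(2) by (auto simp: cops_move_def subdivided_complete_arcs)
        moreover have "cops_win_in ?G 1 (Suc 0) ?cs r''"
          if "robber_move ?G 1 ?cs r' r''" for r''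
        proof -
          have "r'' \<noteq> Inl v" "r'' = r' \<or> r'' = Inl w"
            using robber_move_speed_1[OF that] w by (auto simp: subdivided_complete_arcs doubleton_eq_iff)
          then have "dominated ?G ?cs r''"
            using assms w w1 orig(2) by (auto simp: dominated_def subdivided_complete_arcs)
          then show ?thesis
            by (rule cops_win_in_dominated)
        qed
        ultimately show ?thesis
          unfolding cops_win_in.simps(2)[of _ _ "Suc 0"] by blast
      qed
      have "cops_move ?G [Inl 0, Inl 1] [Inr {0, v}, Inl 1]"
        using v orig(2) by (auto simp: cops_move_def subdivided_complete_arcs)
      with win have "cops_win_in ?G 1 (Suc (Suc (Suc 0))) [Inl 0, Inl 1] r"
        unfolding cops_win_in.simps(2)[of _ _ "Suc (Suc 0)"] orig(1) by blast
      then show ?thesis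
        by blast
    next
      case middle
      have xy: "x \<notin> {0, 1}" "y \<notin> {0, 1}"
        using end_dom[of x y] end_dom[of y x] middle by (auto simp: insert_commute)
      \<comment> \<open>First both ends of the robber's edge are threatened, so that he has to wait;
        then the cops occupy both ends and he is stuck next to them.\<close>
      let ?cs = "[Inr {0, x}, Inr {1, y}]" and ?cs' = "[Inl x, Inl y]"
      have win: "cops_win_in ?G 1 (Suc (Suc 0)) ?cs r'"
        if move: "robber_move ?G 1 ?cs r r'" for r'
      proof (cases "dominated ?G ?cs r'")
        case True
        then show ?thesis
          by (rule cops_win_in_dominated)
      next
        case False
        then have "r' \<noteq> Inl x" "r' \<noteq> Inl y"
          using assms xy middle by (auto simp: dominated_def subdivided_complete_arcs)
        then have r': "r' = r"
          using robber_move_speed_1[OF move] middle by (auto simp: subdivided_complete_arcs doubleton_eq_iff)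
        have "cops_move ?G ?cs ?cs'"
          using assms xy middle by (auto simp: cops_move_def subdivided_complete_arcs)
        moreover have "cops_win_in ?G 1 (Suc 0) ?cs' r''"
          if "robber_move ?G 1 ?cs' r' r''" for r''
        proof -
          have "r'' = r"
            using robber_move_stuck[OF that] middle r' by (auto simp: subdivided_complete_arcs doubleton_eq_iff)
          then have "dominated ?G ?cs' r''"
            using middle by (auto simp: dominated_def subdivided_complete_arcs)
          then show ?thesis
            by (rule cops_win_in_dominated)
        qed
        ultimately show ?thesis
          unfolding cops_win_in.simps(2)[of _ _ "Suc 0"] by blast
      qed
      have "cops_move ?G [Inl 0, Inl 1] ?cs"
        using assms xy middle by (auto simp: cops_move_def subdivided_complete_arcs)
      with win have "cops_win_in ?G 1 (Suc (Suc (Suc 0))) [Inl 0, Inl 1] r"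
        unfolding cops_win_in.simps(2)[of _ _ "Suc (Suc 0)"] by blast
      then show ?thesis
        by blast
    qed
  qed
qed

text \<open>Cop \<open>i\<close> starts on the edge joining \<open>2 * i\<close> to its mate, so the
  original vertex \<open>x\<close> is guarded by cop \<open>x div 2\<close>. Two cop moves suffice:
  occupy both ends of the robber's edge, then step onto him.\<close>

lemma winning_any_speed:
  assumes "n \<ge> 3"
  shows "\<exists>\<sigma>. winning_cop_strategy (subdivided_complete n) R ((n + 1) div 2) \<sigma>"
proof -
  let ?G = "subdivided_complete n" and ?k = "(n + 1) div 2"
  \<comment> \<open>For odd \<open>n\<close> the last vertex \<open>n - 1\<close> has no successor
    to be paired with and takes 0 instead, which differs from it as \<open>n\<close> is at least
    3.\<close>
  define mate where "mate i = (if 2 * i + 1 < n then 2 * i + 1 else 0)" for i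
  define cs\<^sub>0 :: "(nat + nat set) list" where "cs\<^sub>0 = map (\<lambda>i. Inr {2 * i, mate i}) [0..<?k]"
  have len: "length cs\<^sub>0 = ?k"
    by (simp add: cs\<^sub>0_def)
  have mate: "2 * i < n" "mate i < n" "mate i \<noteq> 2 * i" if "i < ?k" for i
    using that assms by (auto simp: mate_def)
  have idx: "x div 2 < ?k" if "x < n" for x
    using that by linarith
  have mates: "x = 2 * (x div 2) \<or> x = mate (x div 2)" if "x < n" for x
    using that by (auto simp: mate_def)
  have cover: "(cs\<^sub>0 ! (x div 2), Inl x) \<in> parcs ?G" if "x < n" for x
  proof -
    have "cs\<^sub>0 ! (x div 2) = Inr {2 * (x div 2), mate (x div 2)}"
      using idx[OF that] by (simp add: cs\<^sub>0_def)
    then show ?thesis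
      using mate[OF idx[OF that]] mates[OF that] by (auto simp: subdivided_complete_arcs)
  qed
  have "\<exists>m. cops_win_in ?G R m cs\<^sub>0 r" if r: "r \<in> pverts ?G" for r
  proof (cases "dominated ?G cs\<^sub>0 r")
    case True
    then show ?thesis
      by (blast intro: cops_win_in_dominated)
  next
    case False
    have "dominated ?G cs\<^sub>0 (Inl x)" if "x < n" for x
      using cover[OF that] idx[OF that] len by (auto simp: dominated_def)
    with False r obtain x y where xy: "x < n" "y < n" "x \<noteq> y" "r = Inr {x, y}"
      by (auto simp: pverts_subdivided_complete)
    \<comment> \<open>If one cop guarded both ends, it would sit on the robber's own middle vertex.
      Hence two different cops can take the two ends at once.\<close>
    have diff: "x div 2 \<noteq> y div 2"
    proof
      assume eq: "x div 2 = y div 2"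
      have "{x, y} = {2 * (x div 2), mate (x div 2)}"
        using eq xy mates[of x] mates[of y] by auto
      then have "r = cs\<^sub>0 ! (x div 2)"
        using xy idx[of x] by (simp add: cs\<^sub>0_def)
      then show False
        using False idx[OF xy(1)] len by (auto simp: dominated_def)
    qed
    let ?cs = "cs\<^sub>0[x div 2 := Inl x, y div 2 := Inl y]"
    have move: "cops_move ?G cs\<^sub>0 ?cs"
      using cover xy diff idx[OF xy(1)] idx[OF xy(2)] len
      by (auto simp: cops_move_def list_all2_conv_all_nth nth_list_update)
    have occ: "Inl x \<in> set ?cs" "Inl y \<in> set ?cs"
      using idx[OF xy(1)] idx[OF xy(2)] len diff
      by (metis length_list_update list_update_swap set_update_memI)+
    have "cops_win_in ?G R (Suc 0) ?cs r'" if "robber_move ?G R ?cs r r'" for r'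
    proof -
      have "r' = r"
        using robber_move_stuck[OF that] occ xy by (auto simp: subdivided_complete_arcs doubleton_eq_iff)
      then have "dominated ?G ?cs r'"
        using occ(1) xy unfolding dominated_def by (intro bexI[of _ "Inl x"]) (auto simp: subdivided_complete_arcs)
      then show ?thesis
        by (rule cops_win_in_dominated)
    qed
    with move have "cops_win_in ?G R (Suc (Suc 0)) cs\<^sub>0 r"
      unfolding cops_win_in.simps(2)[of _ _ "Suc 0"] by blast
    then show ?thesis
      by blast
  qed
  moreover have "set cs\<^sub>0 \<subseteq> pverts ?G"
    using mate by (fastforce simp: cs\<^sub>0_def pverts_subdivided_complete)
  ultimately show ?thesis
    using winning_cop_strategy_if_cops_win_in len by blast
qed

section \<open>Values of the cop number and their growth\<close>

lemma cop_number_speed_1: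
  assumes "n \<ge> 3"
  shows "cop_number 1 (subdivided_complete n) = 2"
  unfolding cop_number_def
proof (rule Least_equality)
  show "\<exists>\<sigma>. winning_cop_strategy (subdivided_complete n) 1 2 \<sigma>"
    by (rule winning_speed_1[OF assms])
next
  fix k
  assume "\<exists>\<sigma>. winning_cop_strategy (subdivided_complete n) 1 k \<sigma>"
  then show "2 \<le> k"
    using not_winning_speed_1[OF assms, of k] by force
qed

lemma cop_number_speed_2:
  assumes "n \<ge> 3"
  shows "cop_number 2 (subdivided_complete n) = (n + 1) div 2"
  unfolding cop_number_def
proof (rule Least_equality)
  show "\<exists>\<sigma>. winning_cop_strategy (subdivided_complete n) 2 ((n + 1) div 2) \<sigma>"
    by (rule winning_any_speed[OF assms])
next
  fix k
  assume "\<exists>\<sigma>. winning_cop_strategy (subdivided_complete n) 2 k \<sigma>"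
  then have "\<not> 2 * k < n"
    using not_winning_speed_2 by blast
  then show "(n + 1) div 2 \<le> k"
    by linarith
qed

theorem proposition5p1:
  shows "(\<forall>n\<ge>3. cop_number 1 (one_subdivision (complete_graph n)) = 2 \<and>
                int (cop_number 2 (one_subdivision (complete_graph n))) = \<lceil>real n / 2\<rceil>) \<and>
         (\<lambda>n. real (cop_number 2 (one_subdivision (complete_graph n))))
           \<in> \<Theta>(\<lambda>n. sqrt (real (card (pverts (one_subdivision (complete_graph n))))))"
proof (intro conjI allI impI)
  fix n :: nat
  assume n: "n \<ge> 3"
  show "cop_number 1 (subdivided_complete n) = 2"
    by (rule cop_number_speed_1[OF n])
  have "\<lceil>real n / 2\<rceil> = int ((n + 1) div 2)"
    by (rule ceiling_unique) linarith+
  then show "int (cop_number 2 (subdivided_complete n)) = \<lceil>real n / 2\<rceil>"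
    using cop_number_speed_2[OF n] by simp
next
  let ?f = "\<lambda>n. real (cop_number 2 (subdivided_complete n))"
    and ?v = "\<lambda>n. real (card (pverts (subdivided_complete n)))"
  \<comment> \<open>With v = n(n+1)/2 one has v <= n^2 <= 4v, so n lies between sqrt v and 2 sqrt v;
    the cop number lies between n/2 and n. This gives the constants 1/2 and 2.\<close>
  have bounds: "1/2 * sqrt (?v n) \<le> ?f n \<and> ?f n \<le> 2 * sqrt (?v n)" if n: "n \<ge> 3" for n
  proof -
    have "real (2 * card (pverts (subdivided_complete n))) = real (n * (n + 1))"
      by (simp only: card_pverts_subdivided_complete)
    then have v: "2 * ?v n = real n * (real n + 1)"
      by (simp add: algebra_simps)
    have f: "real n / 2 \<le> ?f n" "?f n \<le> real n"
      using cop_number_speed_2[OF n] n by linarith+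
    have "real n * 1 \<le> real n * real n"
      using n by (intro mult_left_mono) auto
    with v have "?v n \<le> (real n)\<^sup>2"
      by (simp add: power2_eq_square distrib_left)
    then have "sqrt (?v n) \<le> real n"
      by (rule real_le_lsqrt[rotated 1]) simp
    moreover have "(real n)\<^sup>2 \<le> 4 * ?v n"
      using v by (simp add: power2_eq_square algebra_simps)
    then have "real n \<le> sqrt (4 * ?v n)"
      by (rule real_le_rsqrt)
    ultimately show ?thesis
      using f by (simp add: real_sqrt_mult)
  qed
  show "?f \<in> \<Theta>(\<lambda>n. sqrt (?v n))"
    by (rule bigthetaI'[of "1/2" 2])
      (auto intro!: eventually_sequentiallyI[of 3] simp: bounds[simplified])
qed

end
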